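(* Let $A_n=(\mathrm{wt}_\gamma(\sigma))_{\gamma\in\mathrm{Comp}^B(n),\,\sigma\in\Sigma^B(n)}$ be the $d_n\times d_n$ weight matrix, $d_n=2\cdot3^{n-1}$, with rows and columns in arbitrary fixed linear orders. Then $A_n$ is invertible; in fact $$|\det(A_n)|=\prod_{\gamma\in\mathrm{Comp}^B(n)}m_\gamma,\qquad m_\gamma:=2^{k/2}\prod_{i=1}^k\gamma_i,$$ where $\gamma_1,\dots,\gamma_k$ are the part sizes of $\gamma$.
   Context: $\mathrm{Comp}^B(n)$ is the set of signed compositions of $n$ (compositions $(\gamma_1,\dots,\gamma_k)$ of $n$ with some parts barred). $\Sigma^B(n)$ is the set of pairs $\sigma=(S,\varepsilon)$ with $n\in S\subseteq[n]$ and $\varepsilon:S\to\{-,+\}$; the sign vector is $\tilde\varepsilon(j)=\varepsilon(\min\{s\in S:s\ge j\})$. For $\gamma$ with $r_i=\gamma_1+\dots+\gamma_i$, $r_0=0$, $S(\gamma)=\{r_1,\dots,r_k\}$, $I_i=\{r_{i-1}+1,\dots,r_i\}$: $\mathrm{wt}_\gamma(\sigma)=0$ if for some $i$ the set $S\cap\{r_{i-1}+1,\dots,r_i-1\}$ is not an initial segment of $\{r_{i-1}+1,\dots,r_i-1\}$ or $\tilde\varepsilon$ is not constant on $I_i$; otherwise $\mathrm{wt}_\gamma(\sigma)=(-1)^{|S\setminus S(\gamma)|+n_\gamma(\sigma)}$, where $n_\gamma(\sigma)$ is the number of $i$ with $\tilde\varepsilon=-$ on $I_i$ and $\gamma_i$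 barred. *)

theory Defs
  imports Complex_Main "HOL-Library.FuncSet" "Jordan_Normal_Form.Determinant"
begin

text \<open>A signed composition is the list of its parts, each part being its size together with a
  flag that is \<^const>\<open>True\<close> iff the part is barred.\<close>

type_synonym signed_composition = "(nat \<times> bool) list"

definition CompB :: "nat \<Rightarrow> signed_composition set" where
  "CompB n = {\<gamma>. (\<forall>p\<in>set \<gamma>. fst p > 0) \<and> sum_list (map fst \<gamma>) = n}"

datatype sign = Minus | Plus

text \<open>A map with domain \<open>S\<close> is represented by its extensional version, so that distinct elements
  of the set below are distinct mathematical pairs.\<close>

definition SigmaB :: "nat \<Rightarrow> (nat set \<times> (nat \<Rightarrow> sign)) set" where
  "SigmaB n = {(S, \<epsilon>). n \<in> S \<and> S \<subseteq> {1..n} \<and> \<epsilon> \<in> S \<rightarrow>\<^sub>E UNIV}"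

definition sign_vector :: "nat set \<times> (nat \<Rightarrow> sign) \<Rightarrow> nat \<Rightarrow> sign" where
  "sign_vector \<sigma> j = snd \<sigma> (Min {s \<in> fst \<sigma>. j \<le> s})"

definition partial_sum :: "signed_composition \<Rightarrow> nat \<Rightarrow> nat" where
  "partial_sum \<gamma> i = sum_list (take i (map fst \<gamma>))"

definition partial_sum_set :: "signed_composition \<Rightarrow> nat set" where
  "partial_sum_set \<gamma> = partial_sum \<gamma> ` {1..length \<gamma>}"

text \<open>Blocks are indexed by \<open>1, \<dots>, length \<gamma>\<close>, whereas list positions start at \<open>0\<close>; hence the
  \<open>i\<close>-th part is \<open>\<gamma> ! (i - 1)\<close>.\<close>

definition block :: "signed_composition \<Rightarrow> nat \<Rightarrow> nat set" where
  "block \<gamma> i = {partial_sum \<gamma> (i - 1) + 1..partial_sum \<gamma> i}"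

definition block_init :: "signed_composition \<Rightarrow> nat \<Rightarrow> nat set" where
  "block_init \<gamma> i = {partial_sum \<gamma> (i - 1) + 1..partial_sum \<gamma> i - 1}"

definition initial_segment :: "nat set \<Rightarrow> nat set \<Rightarrow> bool" where
  "initial_segment T X \<longleftrightarrow> T \<subseteq> X \<and> (\<forall>t\<in>T. \<forall>x\<in>X. x \<le> t \<longrightarrow> x \<in> T)"

definition neg_barred_count ::
    "signed_composition \<Rightarrow> nat set \<times> (nat \<Rightarrow> sign) \<Rightarrow> nat" where
  "neg_barred_count \<gamma> \<sigma> =
     card {i \<in> {1..length \<gamma>}. (\<forall>j\<in>block \<gamma> i. sign_vector \<sigma> j = Minus) \<and> snd (\<gamma> ! (i - 1))}"

definition wt :: "signed_composition \<Rightarrow> nat set \<times> (nat \<Rightarrow> sign) \<Rightarrow> int" where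
  "wt \<gamma> \<sigma> =
     (if \<exists>i\<in>{1..length \<gamma>}.
           \<not> initial_segment (fst \<sigma> \<inter> block_init \<gamma> i) (block_init \<gamma> i) \<or>
           \<not> (\<exists>c. \<forall>j\<in>block \<gamma> i. sign_vector \<sigma> j = c)
      then 0
      else (-1) ^ (card (fst \<sigma> - partial_sum_set \<gamma>) + neg_barred_count \<gamma> \<sigma>))"

text \<open>The two lists enumerate the row and column index sets and thereby fix their linear orders.\<close>

definition weight_matrix ::
    "signed_composition list \<Rightarrow> (nat set \<times> (nat \<Rightarrow> sign)) list \<Rightarrow> real mat" where
  "weight_matrix rs cs =
     mat (length rs) (length cs) (\<lambda>(a, b). of_int (wt (rs ! a) (cs ! b)))"

definition m_comp :: "signed_composition \<Rightarrow> real" where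
  "m_comp \<gamma> = 2 powr (real (length \<gamma>) / 2) * (\<Prod>p\<leftarrow>\<gamma>. real (fst p))"

end

theory Submission
  imports Defs
begin

text \<open>
  Identify \<open>\<sigma>\<close> with its set \<open>S\<close> and its sign vector. The weight matrix factors as \<open>A = H B\<close>: the rows
  of \<open>H\<close> are the characters recording the bars of \<open>\<gamma>\<close> on the sign choices for its blocks, so that
  \<open>H H\<^sup>T\<close> is diagonal with entries \<open>2\<^sup>k\<close>, while \<open>B\<close> preserves sign vectors and carries the weight
  \<open>(-1)^|S - T|\<close>. In the language of noncommutative symmetric functions \<open>B\<close> expands power sums into
  ribbons. Multiplying by the unitriangular matrix \<open>C\<close> expanding ribbons into complete functions
  makes it triangular for inclusion: the coefficient of \<open>U\<close> in the row of \<open>T\<close> cancels unless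
  \<open>T \<subseteq> U\<close>, and the diagonal entry counts the sets \<open>S \<supseteq> T\<close> meeting the interior of each block
  of \<open>T\<close> in an initial segment, of which there are \<open>\<gamma>\<^sub>1 \<cdots> \<gamma>\<^sub>k\<close>.
\<close>

subsection \<open>Matrices indexed by lists\<close>

definition family_mat :: "('a \<Rightarrow> 'b \<Rightarrow> 'c) \<Rightarrow> 'a list \<Rightarrow> 'b list \<Rightarrow> 'c mat" where
  "family_mat f xs ys = mat (length xs) (length ys) (\<lambda>(i, j). f (xs ! i) (ys ! j))"

lemma family_mat_carrier [simp]: "family_mat f xs ys \<in> carrier_mat (length xs) (length ys)"
  by (simp add: family_mat_def)

lemma sum_nth_distinct:
  assumes "distinct ys"
  shows "(\<Sum>k = 0..<length ys. f (ys ! k)) = sum f (set ys)"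
  by (rule sum.reindex_bij_betw[OF bij_betw_nth[OF assms]]) auto

lemma prod_nth_distinct:
  assumes "distinct ys"
  shows "(\<Prod>k = 0..<length ys. f (ys ! k)) = prod f (set ys)"
  by (rule prod.reindex_bij_betw[OF bij_betw_nth[OF assms]]) auto

text \<open>Lets matrix factorizations be checked as identities of sums over index sets. A middle
  list without repetitions turns the sum over positions into a sum over its elements.\<close>

lemma family_mat_mult:
  fixes f :: "'a \<Rightarrow> 'b \<Rightarrow> 'd :: semiring_0"
  assumes "distinct ys"
    and "\<And>x z. x \<in> set xs \<Longrightarrow> z \<in> set zs \<Longrightarrow> (\<Sum>y\<in>set ys. f x y * g y z) = h x z"
  shows "family_mat f xs ys * family_mat g ys zs = family_mat h xs zs"
proof (rule eq_matI)
  fix i j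
  assume "i < dim_row (family_mat h xs zs)" "j < dim_col (family_mat h xs zs)"
  then have ij: "i < length xs" "j < length zs" by (auto simp: family_mat_def)
  then have "(family_mat f xs ys * family_mat g ys zs) $$ (i, j) =
      (\<Sum>k = 0..<length ys. f (xs ! i) (ys ! k) * g (ys ! k) (zs ! j))"
    by (simp add: family_mat_def scalar_prod_def)
  also have "\<dots> = (\<Sum>y\<in>set ys. f (xs ! i) y * g y (zs ! j))"
    by (rule sum_nth_distinct[OF assms(1)])
  also have "\<dots> = family_mat h xs zs $$ (i, j)"
    using ij assms(2) by (simp add: family_mat_def)
  finally show "(family_mat f xs ys * family_mat g ys zs) $$ (i, j) = family_mat h xs zs $$ (i, j)" .
qed (auto simp: family_mat_def)

lemma transpose_family_mat:
  "transpose_mat (family_mat f xs ys) = family_mat (\<lambda>y x. f x y) ys xs"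
  by (rule eq_matI) (auto simp: family_mat_def)

text \<open>A permutation \<open>p\<close> contributing to the Leibniz expansion never decreases the rank \<open>r\<close>, and the
  total rank is preserved, so \<open>p\<close> is the identity.\<close>

lemma det_family_mat_triangular:
  fixes f :: "'a \<Rightarrow> 'a \<Rightarrow> 'c :: idom" and r :: "'a \<Rightarrow> int"
  assumes "distinct xs"
    and tri: "\<And>x y. x \<in> set xs \<Longrightarrow> y \<in> set xs \<Longrightarrow> f x y \<noteq> 0 \<Longrightarrow> x = y \<or> r x < r y"
  shows "det (family_mat f xs xs) = (\<Prod>x\<in>set xs. f x x)"
proof -
  let ?n = "length xs" and ?M = "family_mat f xs xs"
  have zero: "(\<Prod>i = 0..<?n. ?M $$ (i, p i)) = 0" if p: "p permutes {0..<?n}" and "p \<noteq> id" for p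
  proof (rule ccontr)
    assume nz: "(\<Prod>i = 0..<?n. ?M $$ (i, p i)) \<noteq> 0"
    have less: "p i < ?n" if "i < ?n" for i
      using permutes_in_image[OF p, of i] that by auto
    have step: "p i = i \<or> r (xs ! i) < r (xs ! p i)" if "i < ?n" for i
    proof -
      have "?M $$ (i, p i) \<noteq> 0" using nz that by auto
      then have "f (xs ! i) (xs ! p i) \<noteq> 0"
        using that less[OF that] by (simp add: family_mat_def)
      then have "xs ! i = xs ! p i \<or> r (xs ! i) < r (xs ! p i)"
        using that less[OF that] by (intro tri) auto
      then show ?thesis
        using that less[OF that] nth_eq_iff_index_eq[OF assms(1)] by auto
    qed
    obtain k where "p k \<noteq> k" using \<open>p \<noteq> id\<close> by (metis eq_id_iff)
    then have k: "k < ?n" using permutes_not_in[OF p] by auto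
    have "(\<Sum>i = 0..<?n. r (xs ! i)) < (\<Sum>i = 0..<?n. r (xs ! p i))"
      using step k \<open>p k \<noteq> k\<close>
      by (intro sum_strict_mono_ex1) (force intro: less_imp_le)+
    moreover have "(\<Sum>i = 0..<?n. r (xs ! p i)) = (\<Sum>i = 0..<?n. r (xs ! i))"
      using sum.permute[OF p, of "\<lambda>i. r (xs ! i)"] by (simp add: comp_def)
    ultimately show False by simp
  qed
  have "det ?M = (\<Sum>p | p permutes {0..<?n}. signof p * (\<Prod>i = 0..<?n. ?M $$ (i, p i)))"
    by (rule det_def') simp
  also have "\<dots> = (\<Sum>p\<in>{id}. signof p * (\<Prod>i = 0..<?n. ?M $$ (i, p i)))"
    by (rule sum.mono_neutral_right) (auto simp: zero finite_permutations permutes_id)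
  also have "\<dots> = (\<Prod>i = 0..<?n. f (xs ! i) (xs ! i))"
    by (simp add: family_mat_def)
  also have "\<dots> = (\<Prod>x\<in>set xs. f x x)"
    by (rule prod_nth_distinct[OF assms(1)])
  finally show ?thesis .
qed

lemma invertible_mat_of_det_ne_0:
  fixes A :: "'a :: field mat"
  assumes A: "A \<in> carrier_mat n n" and "det A \<noteq> 0"
  shows "invertible_mat A"
proof -
  \<comment> \<open>\<open>()\<close> fills the extension field of the matrix ring record; the units
    of that ring are the matrices with a two-sided inverse.\<close>
  obtain B where "B \<in> carrier_mat n n" "B * A = 1\<^sub>m n" "A * B = 1\<^sub>m n"
    using det_non_zero_imp_unit[OF assms, of "()"] by (auto simp: Units_def ring_mat_def)
  then show ?thesis
    using A by (auto simp: invertible_mat_def inverts_mat_def)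
qed

subsection \<open>Blocks of a signed composition\<close>

text \<open>Each bar is recorded at the right end of its block. Together with
  \<open>partial_sum_set\<close>, which contains it, this set encodes \<gamma> as a pair of
  sets.\<close>

definition bar_set :: "signed_composition \<Rightarrow> nat set" where
  "bar_set \<gamma> = partial_sum \<gamma> ` {i \<in> {1..length \<gamma>}. snd (\<gamma> ! (i - 1))}"

lemma partial_sum_0 [simp]: "partial_sum \<gamma> 0 = 0"
  by (simp add: partial_sum_def)

lemma partial_sum_Suc:
  "i < length \<gamma> \<Longrightarrow> partial_sum \<gamma> (Suc i) = partial_sum \<gamma> i + fst (\<gamma> ! i)"
  by (simp add: partial_sum_def take_Suc_conv_app_nth)

lemma partial_sum_length: "\<gamma> \<in> CompB n \<Longrightarrow> partial_sum \<gamma> (length \<gamma>) = n"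
  by (simp add: partial_sum_def CompB_def)

lemma partial_sum_less:
  assumes "\<gamma> \<in> CompB n" "i < j" "j \<le> length \<gamma>"
  shows "partial_sum \<gamma> i < partial_sum \<gamma> j"
  using assms(2,3)
proof (induction j)
  case (Suc j)
  then have "0 < fst (\<gamma> ! j)" using assms(1) by (auto simp: CompB_def)
  then have "partial_sum \<gamma> j < partial_sum \<gamma> (Suc j)" using Suc by (simp add: partial_sum_Suc)
  with Suc show ?case by (cases "i = j") auto
qed simp

lemma partial_sum_le:
  assumes "\<gamma> \<in> CompB n" "i \<le> j" "j \<le> length \<gamma>"
  shows "partial_sum \<gamma> i \<le> partial_sum \<gamma> j"
  using partial_sum_less[OF assms(1), of i j] assms by (cases "i = j") auto

lemma inj_on_partial_sum:
  assumes "\<gamma> \<in> CompB n"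
  shows "inj_on (partial_sum \<gamma>) {..length \<gamma>}"
proof (rule inj_onI)
  fix i j assume "i \<in> {..length \<gamma>}" "j \<in> {..length \<gamma>}" "partial_sum \<gamma> i = partial_sum \<gamma> j"
  then show "i = j"
    using partial_sum_less[OF assms, of i j] partial_sum_less[OF assms, of j i]
    by (cases i j rule: linorder_cases) auto
qed

lemma card_partial_sum_set:
  assumes "\<gamma> \<in> CompB n"
  shows "card (partial_sum_set \<gamma>) = length \<gamma>"
proof -
  have "inj_on (partial_sum \<gamma>) {1..length \<gamma>}"
    by (rule inj_on_subset[OF inj_on_partial_sum[OF assms]]) auto
  then show ?thesis by (simp add: partial_sum_set_def card_image)
qed

lemma partial_sum_set_subset:
  assumes "\<gamma> \<in> CompB n"
  shows "partial_sum_set \<gamma> \<subseteq> {1..n}"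
proof
  fix x assume "x \<in> partial_sum_set \<gamma>"
  then obtain i where "i \<in> {1..length \<gamma>}" "x = partial_sum \<gamma> i"
    by (auto simp: partial_sum_set_def)
  then show "x \<in> {1..n}"
    using partial_sum_less[OF assms, of 0 i] partial_sum_le[OF assms, of i "length \<gamma>"]
      partial_sum_length[OF assms] by auto
qed

lemma mem_partial_sum_set_total:
  assumes "\<gamma> \<in> CompB n" "0 < n"
  shows "n \<in> partial_sum_set \<gamma>"
proof -
  have "length \<gamma> \<noteq> 0" using assms by (auto simp: CompB_def)
  then show ?thesis
    unfolding partial_sum_set_def partial_sum_length[OF assms(1), symmetric]
    by (intro imageI) (simp add: Suc_le_eq)
qed

lemma bar_set_subset: "bar_set \<gamma> \<subseteq> partial_sum_set \<gamma>"
  by (auto simp: bar_set_def partial_sum_set_def)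

lemma exists_block:
  assumes "\<gamma> \<in> CompB n" "x \<in> {1..n}"
  shows "\<exists>i\<in>{1..length \<gamma>}. x \<in> block \<gamma> i"
proof -
  \<comment> \<open>The block of x ends at the first partial sum that reaches x; as x is positive,
    this is not the sum with index 0.\<close>
  define i where "i = (LEAST i. x \<le> partial_sum \<gamma> i)"
  have ex: "x \<le> partial_sum \<gamma> (length \<gamma>)" using assms partial_sum_length by force
  then have 1: "x \<le> partial_sum \<gamma> i" and 2: "i \<le> length \<gamma>"
    unfolding i_def by (rule LeastI, rule Least_le)
  have "i \<noteq> 0" using 1 assms(2) by (cases "i = 0") auto
  then have "\<not> x \<le> partial_sum \<gamma> (i - 1)"
    unfolding i_def by (intro not_less_Least) (auto simp: i_def)
  then show ?thesis using 1 2 \<open>i \<noteq> 0\<close> by (intro bexI[of _ i]) (auto simp: block_def)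
qed

text \<open>Partial sums increase strictly, so those of smaller index lie to the left of the block
  and those of larger index to its right.\<close>

lemma partial_sum_set_inter_block:
  assumes "\<gamma> \<in> CompB n" "i \<in> {1..length \<gamma>}" "x \<in> block \<gamma> i"
  shows "x \<in> partial_sum_set \<gamma> \<longleftrightarrow> x = partial_sum \<gamma> i"
proof
  assume "x \<in> partial_sum_set \<gamma>"
  then obtain j where j: "j \<in> {1..length \<gamma>}" "x = partial_sum \<gamma> j"
    by (auto simp: partial_sum_set_def)
  have "\<not> j \<le> i - 1"
  proof
    assume "j \<le> i - 1"
    moreover have "i - 1 \<le> length \<gamma>" using assms(2) by auto
    ultimately have "partial_sum \<gamma> j \<le> partial_sum \<gamma> (i - 1)"
      by (rule partial_sum_le[OF assms(1)])
    then show False using assms(3) j by (simp add: block_def)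
  qed
  moreover have "\<not> i < j"
    using partial_sum_less[OF assms(1), of i j] assms j by (auto simp: block_def)
  ultimately have "i = j" by linarith
  then show "x = partial_sum \<gamma> i" using j by simp
qed (use assms in \<open>auto simp: partial_sum_set_def\<close>)

lemma block_subset:
  assumes "\<gamma> \<in> CompB n" "i \<in> {1..length \<gamma>}"
  shows "block \<gamma> i \<subseteq> {1..n}"
  using partial_sum_le[OF assms(1), of i "length \<gamma>"] partial_sum_length[OF assms(1)] assms(2)
  by (auto simp: block_def)

lemma block_init_eq:
  assumes "\<gamma> \<in> CompB n" "i \<in> {1..length \<gamma>}"
  shows "block_init \<gamma> i = block \<gamma> i - partial_sum_set \<gamma>"
proof -
  have "block_init \<gamma> i = block \<gamma> i - {partial_sum \<gamma> i}"
    by (auto simp: block_init_def block_def)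
  also have "\<dots> = block \<gamma> i - partial_sum_set \<gamma>"
    using partial_sum_set_inter_block[OF assms] by blast
  finally show ?thesis .
qed

lemma block_end_mem:
  assumes "\<gamma> \<in> CompB n" "i \<in> {1..length \<gamma>}"
  shows "partial_sum \<gamma> i \<in> block \<gamma> i"
  using partial_sum_less[OF assms(1), of "i - 1" i] assms(2) by (auto simp: block_def)

text \<open>Constancy on an interval amounts to equality at neighbours, and x and x+1 share a block
  exactly when x is not a partial sum. The local form refers to \<gamma> only through its set of
  partial sums.\<close>

lemma constant_on_blocks_iff:
  assumes \<gamma>: "\<gamma> \<in> CompB n"
  shows "(\<forall>i\<in>{1..length \<gamma>}. \<exists>c. \<forall>j\<in>block \<gamma> i. f j = c) \<longleftrightarrow>
    (\<forall>x\<in>{1..n} - partial_sum_set \<gamma>. f x = f (Suc x))"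
proof (intro iffI ballI)
  fix x
  assume const: "\<forall>i\<in>{1..length \<gamma>}. \<exists>c. \<forall>j\<in>block \<gamma> i. f j = c"
    and x: "x \<in> {1..n} - partial_sum_set \<gamma>"
  then obtain i where i: "i \<in> {1..length \<gamma>}" "x \<in> block \<gamma> i"
    using exists_block[OF \<gamma>] by blast
  then have "x \<noteq> partial_sum \<gamma> i" using x by (auto simp: partial_sum_set_def)
  then have "Suc x \<in> block \<gamma> i" using i by (auto simp: block_def)
  then show "f x = f (Suc x)" using const i by metis
next
  fix i
  assume step: "\<forall>x\<in>{1..n} - partial_sum_set \<gamma>. f x = f (Suc x)" and i: "i \<in> {1..length \<gamma>}"
  have "f j = f (partial_sum \<gamma> i)" if j: "j \<in> block \<gamma> i" for j
  proof -
    have "j \<le> partial_sum \<gamma> i" using j by (simp add: block_def)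
    then show ?thesis
    \<comment> \<open>The induction descends from the right end of the block to j.\<close>
    proof (induction rule: inc_induct)
      case (step m)
      have m: "m \<in> block \<gamma> i" using step j by (auto simp: block_def)
      then have "m \<notin> partial_sum_set \<gamma>"
        using partial_sum_set_inter_block[OF \<gamma> i m] step.hyps by simp
      then have "f m = f (Suc m)"
        using m block_subset[OF \<gamma> i] \<open>\<forall>x\<in>{1..n} - partial_sum_set \<gamma>. f x = f (Suc x)\<close> by blast
      then show ?case using step.IH by simp
    qed simp
  qed
  then show "\<exists>c. \<forall>j\<in>block \<gamma> i. f j = c" by blast
qed

text \<open>The condition on initial segments, stated locally: each new element continues a run that starts
  right after an element of \<open>T\<close> or after \<open>0\<close>.\<close>

definition left_filled :: "nat set \<Rightarrow> nat set \<Rightarrow> bool" where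
  "left_filled T S \<longleftrightarrow> (\<forall>x\<in>S - T. x - 1 \<in> insert 0 (S \<union> T))"

text \<open>A subset of an interval is an initial segment when it is closed under predecessors
  inside the interval. The predecessor of the first point of a block is the previous partial sum or
  0, and \<open>left_filled\<close> permits both.\<close>

lemma initial_segments_iff:
  assumes \<gamma>: "\<gamma> \<in> CompB n" and S: "S \<subseteq> {1..n}"
  shows "(\<forall>i\<in>{1..length \<gamma>}. initial_segment (S \<inter> block_init \<gamma> i) (block_init \<gamma> i)) \<longleftrightarrow>
    left_filled (partial_sum_set \<gamma>) S"
proof
  assume init: "\<forall>i\<in>{1..length \<gamma>}. initial_segment (S \<inter> block_init \<gamma> i) (block_init \<gamma> i)"
  show "left_filled (partial_sum_set \<gamma>) S"
    unfolding left_filled_def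
  proof
    fix x assume x: "x \<in> S - partial_sum_set \<gamma>"
    then obtain i where i: "i \<in> {1..length \<gamma>}" "x \<in> block \<gamma> i"
      using exists_block[OF \<gamma>] S by blast
    show "x - 1 \<in> insert 0 (S \<union> partial_sum_set \<gamma>)"
    proof (cases "x - 1 = partial_sum \<gamma> (i - 1)")
      case True
      moreover have "partial_sum \<gamma> (i - 1) \<in> insert 0 (partial_sum_set \<gamma>)"
        using i by (cases "i = 1") (auto simp: partial_sum_set_def intro!: imageI)
      ultimately show ?thesis by auto
    next
      case False
      then have "x - 1 \<in> block \<gamma> i" "x \<in> block_init \<gamma> i"
        using i x by (auto simp: block_def block_init_eq[OF \<gamma>])
      moreover have "x - 1 \<in> S" if "x - 1 \<in> block_init \<gamma> i"
        using init i that x \<open>x \<in> block_init \<gamma> i\<close> unfolding initial_segment_def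
        by (metis DiffD1 IntD1 IntI diff_le_self)
      ultimately show ?thesis using i by (auto simp: block_init_eq[OF \<gamma>])
    qed
  qed
next
  assume filled: "left_filled (partial_sum_set \<gamma>) S"
  show "\<forall>i\<in>{1..length \<gamma>}. initial_segment (S \<inter> block_init \<gamma> i) (block_init \<gamma> i)"
    unfolding initial_segment_def
  proof (intro ballI conjI impI)
    fix i t x
    assume i: "i \<in> {1..length \<gamma>}" and t: "t \<in> S \<inter> block_init \<gamma> i"
      and x: "x \<in> block_init \<gamma> i" and "x \<le> t"
    from \<open>x \<le> t\<close> have "x \<in> S"
    \<comment> \<open>Repeated passage to predecessors carries membership in S from t down to
      x.\<close>
    proof (induction rule: inc_induct)
      case (step m)
      have "m \<in> block_init \<gamma> i" "Suc m \<in> block_init \<gamma> i" "m \<noteq> 0"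
        using step.hyps x t by (auto simp: block_init_def)
      then have "m \<notin> partial_sum_set \<gamma>" "Suc m \<in> S - partial_sum_set \<gamma>"
        using step.IH i by (auto simp: block_init_eq[OF \<gamma>])
      then show ?case
        using bspec[OF filled[unfolded left_filled_def], of "Suc m"] \<open>m \<noteq> 0\<close> by simp
    qed (use t in simp)
    then show "x \<in> S \<inter> block_init \<gamma> i" using x by simp
  qed auto
qed

text \<open>When signs are constant on blocks, the sign of a block can be read at its right end, and
  distinct blocks have distinct right ends.\<close>

lemma neg_barred_count_eq:
  assumes \<gamma>: "\<gamma> \<in> CompB n"
    and const: "\<forall>i\<in>{1..length \<gamma>}. \<exists>c. \<forall>j\<in>block \<gamma> i. sign_vector \<sigma> j = c"
  shows "neg_barred_count \<gamma> \<sigma> = card {t \<in> bar_set \<gamma>. sign_vector \<sigma> t = Minus}"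
proof -
  let ?I = "{i \<in> {1..length \<gamma>}. (\<forall>j\<in>block \<gamma> i. sign_vector \<sigma> j = Minus) \<and> snd (\<gamma> ! (i - 1))}"
  have "(\<forall>j\<in>block \<gamma> i. sign_vector \<sigma> j = Minus) \<longleftrightarrow> sign_vector \<sigma> (partial_sum \<gamma> i) = Minus"
    if "i \<in> {1..length \<gamma>}" for i
    using const that block_end_mem[OF \<gamma> that] by metis
  then have "{t \<in> bar_set \<gamma>. sign_vector \<sigma> t = Minus} = partial_sum \<gamma> ` ?I"
    unfolding bar_set_def by blast
  moreover have "inj_on (partial_sum \<gamma>) ?I"
    by (rule inj_on_subset[OF inj_on_partial_sum[OF \<gamma>]]) auto
  ultimately show ?thesis by (simp add: neg_barred_count_def card_image)
qed

text \<open>Separates the two ingredients of the weight: the bars enter only through the second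
  exponent, everything else only through the set of partial sums. This makes the factorization
  possible.\<close>

lemma wt_eq:
  assumes \<gamma>: "\<gamma> \<in> CompB n" and \<sigma>: "\<sigma> \<in> SigmaB n"
  shows "wt \<gamma> \<sigma> =
    (if left_filled (partial_sum_set \<gamma>) (fst \<sigma>) \<and>
        (\<forall>x\<in>{1..n} - partial_sum_set \<gamma>. sign_vector \<sigma> x = sign_vector \<sigma> (Suc x))
     then (-1) ^ (card (fst \<sigma> - partial_sum_set \<gamma>) +
       card {t \<in> bar_set \<gamma>. sign_vector \<sigma> t = Minus})
     else 0)"
proof -
  have S: "fst \<sigma> \<subseteq> {1..n}" using \<sigma> by (auto simp: SigmaB_def)
  show ?thesis
    unfolding wt_def initial_segments_iff[OF \<gamma> S, symmetric] constant_on_blocks_iff[OF \<gamma>, symmetric]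
    using neg_barred_count_eq[OF \<gamma>, of \<sigma>] by auto
qed

subsection \<open>Signed compositions as signed sets\<close>

text \<open>Inductions over signed compositions remove the last part, because this leaves all
  earlier partial sums unchanged.\<close>

lemma CompB_snoc:
  "\<gamma> @ [(a, b)] \<in> CompB n \<longleftrightarrow> 0 < a \<and> a \<le> n \<and> \<gamma> \<in> CompB (n - a)"
  by (auto simp: CompB_def)

lemma partial_sum_snoc: "i \<le> length \<gamma> \<Longrightarrow> partial_sum (\<gamma> @ [p]) i = partial_sum \<gamma> i"
  by (simp add: partial_sum_def)

lemma partial_sum_set_snoc:
  assumes "\<gamma> @ [p] \<in> CompB n"
  shows "partial_sum_set (\<gamma> @ [p]) = insert n (partial_sum_set \<gamma>)"
proof -
  have "partial_sum (\<gamma> @ [p]) (Suc (length \<gamma>)) = n"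
    using partial_sum_length[OF assms] by simp
  moreover have "partial_sum (\<gamma> @ [p]) ` {1..length \<gamma>} = partial_sum_set \<gamma>"
    unfolding partial_sum_set_def by (intro image_cong) (auto simp: partial_sum_snoc)
  ultimately show ?thesis
    by (simp add: partial_sum_set_def atLeastAtMostSuc_conv)
qed

lemma bar_set_snoc:
  assumes "\<gamma> @ [(a, b)] \<in> CompB n"
  shows "bar_set (\<gamma> @ [(a, b)]) = (if b then insert n (bar_set \<gamma>) else bar_set \<gamma>)"
proof -
  have 1: "{i \<in> {1..length (\<gamma> @ [(a, b)])}. snd ((\<gamma> @ [(a, b)]) ! (i - 1))} =
      (if b then {Suc (length \<gamma>)} else {}) \<union> {i \<in> {1..length \<gamma>}. snd (\<gamma> ! (i - 1))}"
    by (auto simp: nth_append le_Suc_eq)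
  have 2: "partial_sum (\<gamma> @ [(a, b)]) (Suc (length \<gamma>)) = n"
    using partial_sum_length[OF assms] by simp
  have 3: "partial_sum (\<gamma> @ [(a, b)]) ` {i \<in> {1..length \<gamma>}. snd (\<gamma> ! (i - 1))} = bar_set \<gamma>"
    unfolding bar_set_def by (intro image_cong) (auto simp: partial_sum_snoc)
  show ?thesis
    unfolding bar_set_def[of "\<gamma> @ [(a, b)]"] 1 image_Un 3 using 2 by (cases b) simp_all
qed

text \<open>Recovers the total from the set of partial sums; the added 0 covers the empty
  composition.\<close>

lemma Max_partial_sum_set:
  assumes "\<gamma> \<in> CompB n"
  shows "Max (insert 0 (partial_sum_set \<gamma>)) = n"
proof (cases "n = 0")
  case True
  then show ?thesis using partial_sum_set_subset[OF assms] by auto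
next
  case False
  then have "n \<in> partial_sum_set \<gamma>" using mem_partial_sum_set_total[OF assms] by simp
  then show ?thesis
    using partial_sum_set_subset[OF assms] finite_subset[OF partial_sum_set_subset[OF assms]]
    by (intro Max_eqI) auto
qed

text \<open>After removal of n, the largest partial sum determines the size of the last part, and
  membership of n in the bar set determines its bar. The rest follows by induction.\<close>

lemma signed_composition_eqI:
  assumes "\<gamma> \<in> CompB n" "\<gamma>' \<in> CompB n"
    and "partial_sum_set \<gamma> = partial_sum_set \<gamma>'" "bar_set \<gamma> = bar_set \<gamma>'"
  shows "\<gamma> = \<gamma>'"
  using assms
proof (induction \<gamma> arbitrary: n \<gamma>' rule: rev_induct)
  case Nil
  then have "n = 0" by (simp add: CompB_def)
  then show ?case using Nil.prems(2) by (cases \<gamma>') (auto simp: CompB_def)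
next
  case (snoc p \<gamma>)
  obtain a b where p: "p = (a, b)" by force
  have \<gamma>: "0 < a" "a \<le> n" "\<gamma> \<in> CompB (n - a)" using snoc.prems(1) by (auto simp: p CompB_snoc)
  then have "\<gamma>' \<noteq> []" using snoc.prems(2) by (auto simp: CompB_def)
  then obtain \<delta> c d where \<gamma>': "\<gamma>' = \<delta> @ [(c, d)]" by (metis rev_exhaust surj_pair)
  have \<delta>: "0 < c" "c \<le> n" "\<delta> \<in> CompB (n - c)" using snoc.prems(2) by (auto simp: \<gamma>' CompB_snoc)
  have n: "n \<notin> partial_sum_set \<gamma>" "n \<notin> partial_sum_set \<delta>"
    using partial_sum_set_subset[OF \<gamma>(3)] partial_sum_set_subset[OF \<delta>(3)] \<gamma>(1,2) \<delta>(1,2) by auto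
  have "insert n (partial_sum_set \<gamma>) = insert n (partial_sum_set \<delta>)"
    using snoc.prems by (simp add: p \<gamma>' partial_sum_set_snoc)
  with n have T: "partial_sum_set \<gamma> = partial_sum_set \<delta>" by (meson insert_ident)
  then have "n - a = n - c" using Max_partial_sum_set \<gamma>(3) \<delta>(3) by metis
  with \<gamma> \<delta> have ac: "a = c" by simp
  \<comment> \<open>The shortened compositions end before n, so n lies in the full bar set exactly
    when the last part is barred.\<close>
  have nb: "n \<notin> bar_set \<gamma>" "n \<notin> bar_set \<delta>" using n bar_set_subset by blast+
  have bars: "(if b then insert n (bar_set \<gamma>) else bar_set \<gamma>) =
      (if d then insert n (bar_set \<delta>) else bar_set \<delta>)"
    using snoc.prems(4) bar_set_snoc snoc.prems(1,2) unfolding p \<gamma>' by metis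
  then have bd: "b = d" using nb by (metis insertI1)
  then have "bar_set \<gamma> = bar_set \<delta>" using bars nb by (metis insert_ident)
  then have "\<gamma> = \<delta>" using snoc.IH[OF \<gamma>(3) _ T] \<delta>(3) ac by simp
  then show ?case using p \<gamma>' ac bd by simp
qed

lemma exists_signed_composition:
  assumes "T \<subseteq> {1..n}" "0 < n \<Longrightarrow> n \<in> T" "N \<subseteq> T"
  shows "\<exists>\<gamma>\<in>CompB n. partial_sum_set \<gamma> = T \<and> bar_set \<gamma> = N"
  using assms
proof (induction n arbitrary: T N rule: less_induct)
  case (less n)
  show ?case
  proof (cases "n = 0")
    case True
    then show ?thesis using less.prems
      by (intro bexI[of _ "[]"]) (auto simp: CompB_def partial_sum_set_def bar_set_def)
  next
    case False
    \<comment> \<open>The partial sum preceding n, or 0 if there is none; the last part gets size n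
      - m.\<close>
    define m where "m = Max (insert 0 (T - {n}))"
    have fin: "finite (insert 0 (T - {n}))" using less.prems(1) finite_subset by auto
    have "m \<in> insert 0 (T - {n})" unfolding m_def by (rule Max_in[OF fin]) simp
    then have m: "m < n" "0 < m \<Longrightarrow> m \<in> T - {n}" using False less.prems(1) by force+
    have "x \<le> m" if "x \<in> T - {n}" for x using that fin unfolding m_def by (intro Max_ge) auto
    then have sub: "T - {n} \<subseteq> {1..m}" using less.prems(1) by force
    obtain \<gamma> where \<gamma>: "\<gamma> \<in> CompB m" "partial_sum_set \<gamma> = T - {n}" "bar_set \<gamma> = N - {n}"
      using less.IH[OF m(1) sub m(2), of "N - {n}"] less.prems(3) by blast
    let ?\<gamma> = "\<gamma> @ [(n - m, n \<in> N)]"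
    have mem: "?\<gamma> \<in> CompB n" using m(1) \<gamma>(1) by (simp add: CompB_snoc)
    moreover have "partial_sum_set ?\<gamma> = T"
      using less.prems(2) False by (auto simp: partial_sum_set_snoc[OF mem] \<gamma>(2))
    moreover have "bar_set ?\<gamma> = N"
      by (auto simp: bar_set_snoc[OF mem] \<gamma>(3))
    ultimately show ?thesis by blast
  qed
qed

text \<open>Barred parts become minus signs. This identification transports cardinalities and
  products between the row and column index sets.\<close>

definition sigma_of :: "signed_composition \<Rightarrow> nat set \<times> (nat \<Rightarrow> sign)" where
  "sigma_of \<gamma> = (partial_sum_set \<gamma>,
     \<lambda>s\<in>partial_sum_set \<gamma>. if s \<in> bar_set \<gamma> then Minus else Plus)"

lemma fst_sigma_of [simp]: "fst (sigma_of \<gamma>) = partial_sum_set \<gamma>"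
  by (simp add: sigma_of_def)

lemma bij_betw_sigma_of:
  assumes "n \<ge> 1"
  shows "bij_betw sigma_of (CompB n) (SigmaB n)"
proof -
  have neg: "{s \<in> partial_sum_set \<gamma>. snd (sigma_of \<gamma>) s = Minus} = bar_set \<gamma>" for \<gamma>
    using bar_set_subset by (auto simp: sigma_of_def)
  have "inj_on sigma_of (CompB n)"
    using signed_composition_eqI neg by (intro inj_onI) (metis fst_sigma_of)
  moreover have "sigma_of \<gamma> \<in> SigmaB n" if "\<gamma> \<in> CompB n" for \<gamma>
    using partial_sum_set_subset[OF that] mem_partial_sum_set_total[OF that] assms
    by (auto simp: sigma_of_def SigmaB_def)
  moreover have "\<sigma> \<in> sigma_of ` CompB n" if \<sigma>: "\<sigma> \<in> SigmaB n" for \<sigma>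
  proof -
    obtain S \<epsilon> where S: "\<sigma> = (S, \<epsilon>)" "n \<in> S" "S \<subseteq> {1..n}" "\<epsilon> \<in> S \<rightarrow>\<^sub>E UNIV"
      using \<sigma> by (auto simp: SigmaB_def)
    obtain \<gamma> where \<gamma>: "\<gamma> \<in> CompB n" "partial_sum_set \<gamma> = S" "bar_set \<gamma> = {s \<in> S. \<epsilon> s = Minus}"
      using exists_signed_composition[of S n "{s \<in> S. \<epsilon> s = Minus}"] S by auto
    \<comment> \<open>Outside S both sign maps are \<open>undefined\<close>, by
      extensionality.\<close>
    have "sigma_of \<gamma> = \<sigma>"
      unfolding sigma_of_def \<gamma> S(1)
      using S(4)
      by (auto simp: fun_eq_iff restrict_def PiE_def extensional_def intro: sign.exhaust[of "\<epsilon> _"])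
    then show ?thesis using \<gamma>(1) by blast
  qed
  ultimately show ?thesis by (auto simp: bij_betw_def)
qed

section \<open>The number of signed sets\<close>

lemma UNIV_sign: "(UNIV :: sign set) = {Minus, Plus}"
proof -
  have "x \<in> {Minus, Plus}" for x by (cases x) simp_all
  then show ?thesis by blast
qed

instance sign :: finite
  by standard (simp add: UNIV_sign)

text \<open>Each element of A has three states: outside S, or in S with one of two signs.\<close>

lemma sum_Pow_two_power_card:
  "finite A \<Longrightarrow> (\<Sum>S\<in>Pow A. 2 ^ card S) = (3 :: nat) ^ card A"
proof (induction A rule: finite_induct)
  case (insert x A)
  have "(\<Sum>S\<in>Pow (insert x A). 2 ^ card S) =
      (\<Sum>S\<in>Pow A. 2 ^ card S) + (\<Sum>S\<in>insert x ` Pow A. (2 :: nat) ^ card S)"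
    unfolding Pow_insert using insert.hyps by (intro sum.union_disjoint) auto
  also have "(\<Sum>S\<in>insert x ` Pow A. (2 :: nat) ^ card S) = (\<Sum>S\<in>Pow A. 2 ^ card (insert x S))"
    using insert.hyps(2) by (subst sum.reindex) (auto simp: inj_on_def intro!: sum.cong)
  also have "\<dots> = (\<Sum>S\<in>Pow A. 2 * 2 ^ card S)"
  proof (rule sum.cong[OF refl])
    fix S assume "S \<in> Pow A"
    then have "x \<notin> S" "finite S" using insert.hyps finite_subset[of S A] by auto
    then show "(2 :: nat) ^ card (insert x S) = 2 * 2 ^ card S" by simp
  qed
  finally show ?case using insert by (simp flip: sum_distrib_left)
qed simp

lemma SigmaB_eq_Sigma:
  "SigmaB n = Sigma {S. n \<in> S \<and> S \<subseteq> {1..n}} (\<lambda>S. S \<rightarrow>\<^sub>E UNIV)"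
  by (auto simp: SigmaB_def)

lemma finite_SigmaB: "finite (SigmaB n)"
  unfolding SigmaB_eq_Sigma
proof (rule finite_SigmaI)
  show "finite {S. n \<in> S \<and> S \<subseteq> {1..n}}" by simp
  show "finite (S \<rightarrow>\<^sub>E (UNIV :: sign set))" if "S \<in> {S. n \<in> S \<and> S \<subseteq> {1..n}}" for S
    using that finite_subset[of S "{1..n}"] by (intro finite_PiE) auto
qed

text \<open>The forced element n contributes two signs, every smaller element three states.\<close>

lemma card_SigmaB:
  assumes "n \<ge> 1"
  shows "card (SigmaB n) = 2 * 3 ^ (n - 1)"
proof -
  have sets: "{S. n \<in> S \<and> S \<subseteq> {1..n}} = insert n ` Pow {1..<n}"
  proof (intro subset_antisym subsetI)
    fix S assume "S \<in> {S. n \<in> S \<and> S \<subseteq> {1..n}}"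
    then have "S = insert n (S - {n})" "S - {n} \<in> Pow {1..<n}" by force+
    then show "S \<in> insert n ` Pow {1..<n}" by blast
  qed (use assms in auto)
  have fin: "finite S" if "S \<in> {S. n \<in> S \<and> S \<subseteq> {1..n}}" for S
    using that finite_subset[of S "{1..n}"] by auto
  have "card (SigmaB n) = (\<Sum>S\<in>{S. n \<in> S \<and> S \<subseteq> {1..n}}. card (S \<rightarrow>\<^sub>E (UNIV :: sign set)))"
    unfolding SigmaB_eq_Sigma
    using fin by (intro card_SigmaI) (simp_all add: finite_PiE)
  also have "\<dots> = (\<Sum>S\<in>{S. n \<in> S \<and> S \<subseteq> {1..n}}. 2 ^ card S)"
    using fin by (intro sum.cong refl) (simp add: card_PiE UNIV_sign numeral_2_eq_2)
  also have "\<dots> = (\<Sum>S\<in>Pow {1..<n}. 2 ^ card (insert n S))"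
    unfolding sets
    by (subst sum.reindex) (auto intro!: inj_on_inverseI[where g = "\<lambda>S. S - {n}"])
  also have "\<dots> = (\<Sum>S\<in>Pow {1..<n}. 2 * 2 ^ card S)"
  proof (rule sum.cong[OF refl])
    fix S assume "S \<in> Pow {1..<n}"
    then have "n \<notin> S" "finite S" using finite_subset[of S "{1..<n}"] by auto
    then show "(2 :: nat) ^ card (insert n S) = 2 * 2 ^ card S" by simp
  qed
  also have "\<dots> = 2 * 3 ^ (n - 1)"
    by (simp add: sum_Pow_two_power_card flip: sum_distrib_left)
  finally show ?thesis .
qed

subsection \<open>Counting sets filled from the left\<close>

text \<open>The sets contributing to a diagonal entry of the triangular product, see
  \<open>power_sum_coeff_diagonal\<close>.\<close>

definition fillings :: "nat \<Rightarrow> nat set \<Rightarrow> nat set set" where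
  "fillings n T = {S. T \<subseteq> S \<and> S \<subseteq> {1..n} \<and> left_filled T S}"

lemma down_closed_eq_interval:
  fixes Y :: "nat set"
  assumes "finite Y" and "\<And>x. x \<in> Y \<Longrightarrow> m < x" and "\<And>x. x \<in> Y \<Longrightarrow> x - 1 = m \<or> x - 1 \<in> Y"
  shows "Y = {m<..m + card Y}"
proof (cases "Y = {}")
  case False
  define k where "k = Max Y"
  have k: "k \<in> Y" "\<And>x. x \<in> Y \<Longrightarrow> x \<le> k" using assms(1) False by (auto simp: k_def)
  have "x \<in> Y" if x: "m < x" "x \<le> k" for x
    using x(2)
  proof (induction rule: inc_induct)
    case (step i)
    then show ?case using assms(3)[of "Suc i"] x(1) by auto
  qed (rule k(1))
  then have "Y = {m<..k}" using k(2) assms(2) by auto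
  then show ?thesis using assms(2)[OF k(1)] by simp
qed simp

text \<open>The new block has a - 1 interior points, hence a initial segments, of lengths 0 to a -
  1. The choice is independent of the filling of the earlier blocks.\<close>

lemma card_fillings_insert:
  assumes T: "T \<subseteq> {1..m}" "0 < m \<Longrightarrow> m \<in> T" and "0 < a"
  shows "card (fillings (m + a) (insert (m + a) T)) = a * card (fillings m T)"
proof -
  let ?n = "m + a"
  \<comment> \<open>\<open>f\<close> appends an initial segment of length j and the right end of the
    new block; \<open>g\<close> recovers the old filling and j.\<close>
  define f where "f = (\<lambda>(S, j). S \<union> {m<..m + j} \<union> {?n})"
  define g where "g = (\<lambda>X. (X \<inter> {1..m}, card (X \<inter> {m<..<?n})))"
  have nT: "?n \<notin> T" using T(1) assms(3) by auto
  have interval: "X \<inter> {m<..<?n} = {m<..m + card (X \<inter> {m<..<?n})}"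
    if X: "X \<in> fillings ?n (insert ?n T)" for X
  proof (rule down_closed_eq_interval)
    fix x assume x: "x \<in> X \<inter> {m<..<?n}"
    then have "x \<in> X - insert ?n T" using T(1) by auto
    then have "x - 1 \<in> insert 0 (X \<union> insert ?n T)"
      using X by (auto simp: fillings_def left_filled_def)
    moreover have "insert ?n T \<subseteq> X" using X by (simp add: fillings_def)
    ultimately show "x - 1 = m \<or> x - 1 \<in> X \<inter> {m<..<?n}" using x by auto
  qed auto
  have "bij_betw f (fillings m T \<times> {..<a}) (fillings ?n (insert ?n T))"
  proof (rule bij_betw_byWitness[where f' = g])
    show "\<forall>p\<in>fillings m T \<times> {..<a}. g (f p) = p"
    proof
      fix p assume "p \<in> fillings m T \<times> {..<a}"
      then obtain S j where p: "p = (S, j)" "S \<subseteq> {1..m}" "j < a"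
        by (auto simp: fillings_def)
      then have "f p \<inter> {1..m} = S" "f p \<inter> {m<..<?n} = {m<..m + j}" by (auto simp: f_def)
      then show "g (f p) = p" by (simp add: g_def p(1))
    qed
    show "\<forall>X\<in>fillings ?n (insert ?n T). f (g X) = X"
    proof
      fix X assume X: "X \<in> fillings ?n (insert ?n T)"
      have "f (g X) = X \<inter> {1..m} \<union> X \<inter> {m<..<?n} \<union> {?n}"
        unfolding f_def g_def using interval[OF X] by simp
      also have "\<dots> = X"
      proof -
        have "?n \<in> X" "X \<subseteq> {1..?n}" using X by (auto simp: fillings_def)
        then show ?thesis by force
      qed
      finally show "f (g X) = X" .
    qed
    show "f ` (fillings m T \<times> {..<a}) \<subseteq> fillings ?n (insert ?n T)"
    proof
      fix X assume "X \<in> f ` (fillings m T \<times> {..<a})"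
      then obtain S j where X: "X = S \<union> {m<..m + j} \<union> {?n}" and S: "S \<in> fillings m T" and j: "j < a"
        by (auto simp: f_def)
      have "left_filled (insert ?n T) X"
        unfolding left_filled_def
      proof
        fix x assume x: "x \<in> X - insert ?n T"
        show "x - 1 \<in> insert 0 (X \<union> insert ?n T)"
        proof (cases "x \<in> S")
          case True
          then show ?thesis using S x by (auto simp: fillings_def left_filled_def X)
        next
          case False
          then have "m < x" "x \<le> m + j" using x X by auto
          \<comment> \<open>The first interior point has predecessor m, which is in T or equals
            0.\<close>
          then show ?thesis using T(2) by (cases "x = Suc m") (auto simp: X)
        qed
      qed
      then show "X \<in> fillings ?n (insert ?n T)"
        using S j T(1) assms(3) by (force simp: fillings_def X)
    qed
    show "g ` fillings ?n (insert ?n T) \<subseteq> fillings m T \<times> {..<a}"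
    proof
      fix p assume "p \<in> g ` fillings ?n (insert ?n T)"
      then obtain X where X: "X \<in> fillings ?n (insert ?n T)" and p: "p = g X" by blast
      have "left_filled T (X \<inter> {1..m})"
        unfolding left_filled_def
      proof
        fix x assume x: "x \<in> X \<inter> {1..m} - T"
        then have "x \<in> X - insert ?n T" using assms(3) by auto
        then have "x - 1 \<in> insert 0 (X \<union> insert ?n T)"
          using X by (auto simp: fillings_def left_filled_def)
        then show "x - 1 \<in> insert 0 (X \<inter> {1..m} \<union> T)" using x by auto
      qed
      then have "X \<inter> {1..m} \<in> fillings m T" using X T(1) by (auto simp: fillings_def)
      moreover have "card (X \<inter> {m<..<?n}) \<le> card {m<..<?n}" by (rule card_mono) auto
      ultimately show "p \<in> fillings m T \<times> {..<a}" using assms(3) by (auto simp: p g_def)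
    qed
  qed
  then show ?thesis by (simp add: bij_betw_same_card[symmetric] card_cartesian_product)
qed

lemma card_fillings_partial_sum_set:
  "\<gamma> \<in> CompB n \<Longrightarrow> card (fillings n (partial_sum_set \<gamma>)) = (\<Prod>p\<leftarrow>\<gamma>. fst p)"
proof (induction \<gamma> arbitrary: n rule: rev_induct)
  case Nil
  then have "fillings n (partial_sum_set []) = {{}}"
    by (auto simp: fillings_def CompB_def partial_sum_set_def left_filled_def)
  then show ?case by simp
next
  case (snoc p \<gamma>)
  obtain a b where p: "p = (a, b)" by force
  have \<gamma>: "0 < a" "a \<le> n" "\<gamma> \<in> CompB (n - a)" using snoc.prems by (auto simp: p CompB_snoc)
  have "card (fillings (n - a + a) (insert (n - a + a) (partial_sum_set \<gamma>))) =
      a * card (fillings (n - a) (partial_sum_set \<gamma>))"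
    using \<gamma> partial_sum_set_subset[OF \<gamma>(3)] mem_partial_sum_set_total[OF \<gamma>(3)]
    by (intro card_fillings_insert) auto
  then show ?case
    unfolding partial_sum_set_snoc[OF snoc.prems] using snoc.IH[OF \<gamma>(3)] \<gamma>(2)
    by (simp add: p mult.commute)
qed

subsection \<open>Sign vectors\<close>

lemma sign_vector_mem:
  assumes "finite (fst \<sigma>)" "s \<in> fst \<sigma>"
  shows "sign_vector \<sigma> s = snd \<sigma> s"
proof -
  have "Min {t \<in> fst \<sigma>. s \<le> t} = s" using assms by (intro Min_eqI) auto
  then show ?thesis by (simp add: sign_vector_def)
qed

lemma sign_vector_Suc:
  assumes "x \<notin> fst \<sigma>"
  shows "sign_vector \<sigma> x = sign_vector \<sigma> (Suc x)"
proof -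
  have "{s \<in> fst \<sigma>. x \<le> s} = {s \<in> fst \<sigma>. Suc x \<le> s}"
    using assms by (auto simp: Suc_le_eq order.strict_iff_order)
  then show ?thesis by (simp add: sign_vector_def)
qed

text \<open>Sampling v on S loses nothing when v can change only right after an element of S:
  descending from n, the value is constant until the next element of S.\<close>

lemma sign_vector_restrict:
  assumes "n \<in> S" "S \<subseteq> {1..n}" "\<And>x. x \<in> {1..n} - S \<Longrightarrow> v x = v (Suc x)" "j \<in> {1..n}"
  shows "sign_vector (S, restrict v S) j = v j"
proof -
  have mem: "sign_vector (S, restrict v S) s = v s" if "s \<in> S" for s
    using that finite_subset[OF assms(2)] by (subst sign_vector_mem) auto
  have "j \<le> n" using assms(4) by simp
  then show ?thesis
  proof (induction rule: inc_induct)
    case (step i)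
    show ?case
    proof (cases "i \<in> S")
      case False
      then have "sign_vector (S, restrict v S) i = sign_vector (S, restrict v S) (Suc i)"
        by (intro sign_vector_Suc) simp
      also note step.IH
      also have "v (Suc i) = v i" using False step.hyps assms(3)[of i] assms(4) by simp
      finally show ?thesis .
    qed (rule mem)
  qed (rule mem[OF assms(1)])
qed

definition same_signs :: "nat \<Rightarrow> nat set \<times> (nat \<Rightarrow> sign) \<Rightarrow> nat set \<times> (nat \<Rightarrow> sign) \<Rightarrow> bool" where
  "same_signs n \<sigma> \<tau> \<longleftrightarrow> (\<forall>j\<in>{1..n}. sign_vector \<sigma> j = sign_vector \<tau> j)"

lemma SigmaB_D:
  assumes "\<sigma> \<in> SigmaB n"
  shows "n \<in> fst \<sigma>" "fst \<sigma> \<subseteq> {1..n}" "finite (fst \<sigma>)" "snd \<sigma> \<in> fst \<sigma> \<rightarrow>\<^sub>E UNIV"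
  using assms finite_subset[of "fst \<sigma>" "{1..n}"] by (auto simp: SigmaB_def)

lemma restrict_mem_SigmaB: "n \<in> S \<Longrightarrow> S \<subseteq> {1..n} \<Longrightarrow> (S, restrict v S) \<in> SigmaB n"
  by (auto simp: SigmaB_def)

text \<open>On S the sign vector equals the stored sign, and extensionality fixes the rest. Hence
  sums over \<sigma> with prescribed sign vector reduce to sums over sets.\<close>

lemma SigmaB_eq_restrict:
  assumes \<sigma>: "\<sigma> \<in> SigmaB n" and "\<And>j. j \<in> {1..n} \<Longrightarrow> sign_vector \<sigma> j = v j"
  shows "\<sigma> = (fst \<sigma>, restrict v (fst \<sigma>))"
proof -
  have "snd \<sigma> s = v s" if "s \<in> fst \<sigma>" for s
    using that assms(2)[of s] SigmaB_D[OF \<sigma>] sign_vector_mem[of \<sigma> s] by auto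
  then have "snd \<sigma> = restrict v (fst \<sigma>)"
    using SigmaB_D(4)[OF \<sigma>] by (auto simp: fun_eq_iff restrict_def PiE_def extensional_def)
  then show ?thesis by (metis prod.collapse)
qed

lemma same_signs_eqI:
  assumes "\<sigma> \<in> SigmaB n" "\<tau> \<in> SigmaB n" "fst \<sigma> = fst \<tau>" "same_signs n \<sigma> \<tau>"
  shows "\<sigma> = \<tau>"
proof -
  have "\<sigma> = (fst \<sigma>, restrict (sign_vector \<tau>) (fst \<sigma>))"
    using assms(4) by (intro SigmaB_eq_restrict[OF assms(1)]) (simp add: same_signs_def)
  moreover have "\<tau> = (fst \<tau>, restrict (sign_vector \<tau>) (fst \<tau>))"
    by (intro SigmaB_eq_restrict[OF assms(2)]) simp
  ultimately show ?thesis using assms(3) by simp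
qed

subsection \<open>Factorization of the weight matrix\<close>

text \<open>A character of the group of sign choices on the blocks of \<gamma>, extended by zero to
  all other underlying sets.\<close>

definition bar_character :: "signed_composition \<Rightarrow> nat set \<times> (nat \<Rightarrow> sign) \<Rightarrow> real" where
  "bar_character \<gamma> \<tau> =
     (if fst \<tau> = partial_sum_set \<gamma> then (-1) ^ card {t \<in> bar_set \<gamma>. snd \<tau> t = Minus} else 0)"

definition unsigned_wt ::
    "nat \<Rightarrow> nat set \<times> (nat \<Rightarrow> sign) \<Rightarrow> nat set \<times> (nat \<Rightarrow> sign) \<Rightarrow> real" where
  "unsigned_wt n \<tau> \<sigma> =
     (if left_filled (fst \<tau>) (fst \<sigma>) \<and> same_signs n \<tau> \<sigma> then (-1) ^ card (fst \<sigma> - fst \<tau>) else 0)"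

text \<open>For a fixed sign vector, the Moebius function of inclusion of sets.\<close>

definition moebius ::
    "nat \<Rightarrow> nat set \<times> (nat \<Rightarrow> sign) \<Rightarrow> nat set \<times> (nat \<Rightarrow> sign) \<Rightarrow> real" where
  "moebius n \<sigma> \<upsilon> =
     (if fst \<upsilon> \<subseteq> fst \<sigma> \<and> same_signs n \<sigma> \<upsilon> then (-1) ^ card (fst \<sigma> - fst \<upsilon>) else 0)"

text \<open>Only one \<tau> can contribute: the first factor fixes its set, the second its sign
  vector.\<close>

lemma sum_bar_character_unsigned_wt:
  assumes n: "n \<ge> 1" and \<gamma>: "\<gamma> \<in> CompB n" and \<sigma>: "\<sigma> \<in> SigmaB n"
  shows "(\<Sum>\<tau>\<in>SigmaB n. bar_character \<gamma> \<tau> * unsigned_wt n \<tau> \<sigma>) = real_of_int (wt \<gamma> \<sigma>)"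
proof -
  let ?T = "partial_sum_set \<gamma>"
  let ?\<tau> = "(?T, restrict (sign_vector \<sigma>) ?T)"
  have T: "n \<in> ?T" "?T \<subseteq> {1..n}"
    using mem_partial_sum_set_total[OF \<gamma>] partial_sum_set_subset[OF \<gamma>] n by auto
  have \<tau>: "?\<tau> \<in> SigmaB n" using T by (rule restrict_mem_SigmaB)
  have "bar_character \<gamma> \<tau> * unsigned_wt n \<tau> \<sigma> = 0" if "\<tau> \<in> SigmaB n - {?\<tau>}" for \<tau>
  proof (rule ccontr)
    assume "bar_character \<gamma> \<tau> * unsigned_wt n \<tau> \<sigma> \<noteq> 0"
    then have "fst \<tau> = ?T" "same_signs n \<tau> \<sigma>"
      by (auto simp: bar_character_def unsigned_wt_def split: if_splits)
    then have "\<tau> = ?\<tau>"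
      using SigmaB_eq_restrict[of \<tau> n "sign_vector \<sigma>"] that by (auto simp: same_signs_def)
    then show False using that by simp
  qed
  then have "(\<Sum>\<tau>\<in>SigmaB n. bar_character \<gamma> \<tau> * unsigned_wt n \<tau> \<sigma>) =
      (\<Sum>\<tau>\<in>{?\<tau>}. bar_character \<gamma> \<tau> * unsigned_wt n \<tau> \<sigma>)"
    using \<tau> by (intro sum.mono_neutral_right finite_SigmaB) auto
  also have "\<dots> = bar_character \<gamma> ?\<tau> * unsigned_wt n ?\<tau> \<sigma>" by simp
  also have "\<dots> = real_of_int (wt \<gamma> \<sigma>)"
  proof -
    \<comment> \<open>The candidate has the sign vector of \<sigma> exactly when that vector is
      constant on the blocks of \<gamma>, one of the two conditions for a nonzero weight.\<close>
    have signs: "same_signs n ?\<tau> \<sigma> \<longleftrightarrow>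
        (\<forall>x\<in>{1..n} - ?T. sign_vector \<sigma> x = sign_vector \<sigma> (Suc x))"
    proof (intro iffI ballI)
      fix x assume same: "same_signs n ?\<tau> \<sigma>" and x: "x \<in> {1..n} - ?T"
      then have "x \<noteq> n" using T(1) by auto
      then have "Suc x \<in> {1..n}" using x by auto
      then show "sign_vector \<sigma> x = sign_vector \<sigma> (Suc x)"
        using same x sign_vector_Suc[of x ?\<tau>] by (auto simp: same_signs_def)
    next
      assume "\<forall>x\<in>{1..n} - ?T. sign_vector \<sigma> x = sign_vector \<sigma> (Suc x)"
      then show "same_signs n ?\<tau> \<sigma>"
        using sign_vector_restrict[OF T, of "sign_vector \<sigma>"] by (simp add: same_signs_def)
    qed
    have "{t \<in> bar_set \<gamma>. snd ?\<tau> t = Minus} = {t \<in> bar_set \<gamma>. sign_vector \<sigma> t = Minus}"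
      using bar_set_subset[of \<gamma>] by auto
    then show ?thesis
      unfolding wt_eq[OF \<gamma> \<sigma>] bar_character_def unsigned_wt_def signs
      by (simp add: power_add)
  qed
  finally show ?thesis .
qed

text \<open>Different sets of partial sums give disjoint supports. For equal sets the sum factors
  over the blocks: a block contributes 1 + 1 where the bars agree and 1 - 1 where they
  differ.\<close>

lemma sum_bar_character_orthogonal:
  assumes n: "n \<ge> 1" and \<gamma>: "\<gamma> \<in> CompB n" and \<gamma>': "\<gamma>' \<in> CompB n"
  shows "(\<Sum>\<tau>\<in>SigmaB n. bar_character \<gamma> \<tau> * bar_character \<gamma>' \<tau>) =
    (if \<gamma> = \<gamma>' then 2 ^ length \<gamma> else 0)"
proof (cases "partial_sum_set \<gamma> = partial_sum_set \<gamma>'")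
  case False
  then have "bar_character \<gamma> \<tau> * bar_character \<gamma>' \<tau> = 0" for \<tau>
    by (simp add: bar_character_def)
  then have "(\<Sum>\<tau>\<in>SigmaB n. bar_character \<gamma> \<tau> * bar_character \<gamma>' \<tau>) = 0"
    by (intro sum.neutral) blast
  then show ?thesis using False by auto
next
  case eq: True
  define T where "T = partial_sum_set \<gamma>"
  have T: "n \<in> T" "T \<subseteq> {1..n}" "finite T"
    using mem_partial_sum_set_total[OF \<gamma>] partial_sum_set_subset[OF \<gamma>] n
      finite_subset[of T "{1..n}"] by (auto simp: T_def)
  \<comment> \<open>The local factor of the character at the block ending in t.\<close>
  define \<phi> :: "nat set \<Rightarrow> nat \<Rightarrow> sign \<Rightarrow> real"
    where "\<phi> N t s = (if t \<in> N \<and> s = Minus then -1 else 1)" for N t s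
  have char: "bar_character \<delta> (T, \<epsilon>) = (\<Prod>t\<in>T. \<phi> (bar_set \<delta>) t (\<epsilon> t))"
    if "partial_sum_set \<delta> = T" for \<delta> \<epsilon>
  proof -
    have "{t \<in> bar_set \<delta>. \<epsilon> t = Minus} = {t \<in> T. t \<in> bar_set \<delta> \<and> \<epsilon> t = Minus}"
      using bar_set_subset[of \<delta>] that by auto
    then show ?thesis
      using that T(3) by (simp add: bar_character_def \<phi>_def flip: prod.inter_filter)
  qed
  have "(\<Sum>\<tau>\<in>SigmaB n. bar_character \<gamma> \<tau> * bar_character \<gamma>' \<tau>) =
      (\<Sum>\<tau>\<in>Pair T ` (T \<rightarrow>\<^sub>E UNIV). bar_character \<gamma> \<tau> * bar_character \<gamma>' \<tau>)"
    using T by (intro sum.mono_neutral_right finite_SigmaB)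
      (auto simp: SigmaB_def bar_character_def T_def)
  also have "\<dots> = (\<Sum>\<epsilon>\<in>T \<rightarrow>\<^sub>E UNIV. bar_character \<gamma> (T, \<epsilon>) * bar_character \<gamma>' (T, \<epsilon>))"
    by (subst sum.reindex) (auto simp: inj_on_def)
  also have "\<dots> = (\<Sum>\<epsilon>\<in>T \<rightarrow>\<^sub>E UNIV. \<Prod>t\<in>T. \<phi> (bar_set \<gamma>) t (\<epsilon> t) * \<phi> (bar_set \<gamma>') t (\<epsilon> t))"
    using char[of \<gamma>] char[of \<gamma>'] eq by (simp add: T_def prod.distrib)
  also have "\<dots> = (\<Prod>t\<in>T. \<Sum>s\<in>UNIV. \<phi> (bar_set \<gamma>) t s * \<phi> (bar_set \<gamma>') t s)"
    using T(3) by (intro prod_sum_PiE[symmetric]) auto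
  also have "\<dots> = (\<Prod>t\<in>T. if t \<in> bar_set \<gamma> \<longleftrightarrow> t \<in> bar_set \<gamma>' then 2 else 0)"
    by (intro prod.cong) (auto simp: \<phi>_def UNIV_sign)
  also have "\<dots> = (if \<gamma> = \<gamma>' then 2 ^ length \<gamma> else 0)"
  proof (cases "\<gamma> = \<gamma>'")
    case True
    then show ?thesis using card_partial_sum_set[OF \<gamma>] by (simp add: T_def)
  next
    case False
    then have "bar_set \<gamma> \<noteq> bar_set \<gamma>'" using signed_composition_eqI[OF \<gamma> \<gamma>' eq] by blast
    then obtain t where "t \<in> T" "\<not> (t \<in> bar_set \<gamma> \<longleftrightarrow> t \<in> bar_set \<gamma>')"
      using bar_set_subset[of \<gamma>] bar_set_subset[of \<gamma>'] eq unfolding T_def by blast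
    then show ?thesis using False T(3) by (auto intro!: prod_zero)
  qed
  finally show ?thesis .
qed

section \<open>Power sums expanded into complete functions\<close>

definition power_sum_coeff ::
    "nat \<Rightarrow> nat set \<times> (nat \<Rightarrow> sign) \<Rightarrow> nat set \<times> (nat \<Rightarrow> sign) \<Rightarrow> real" where
  "power_sum_coeff n \<tau> \<upsilon> = (\<Sum>\<sigma>\<in>SigmaB n. unsigned_wt n \<tau> \<sigma> * moebius n \<sigma> \<upsilon>)"

text \<open>All three sign vectors must agree, so \<sigma> is determined by its set S. Conversely,
  every S containing the set of \<upsilon> carries the sign vector of \<upsilon>, which changes only
  right after elements of that set.\<close>

lemma power_sum_coeff_eq:
  assumes \<upsilon>: "\<upsilon> \<in> SigmaB n"
  shows "power_sum_coeff n \<tau> \<upsilon> =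
    (if same_signs n \<tau> \<upsilon>
     then \<Sum>S | fst \<upsilon> \<subseteq> S \<and> S \<subseteq> {1..n} \<and> left_filled (fst \<tau>) S.
       (-1) ^ card (S - fst \<tau>) * (-1) ^ card (S - fst \<upsilon>)
     else 0)"
proof (cases "same_signs n \<tau> \<upsilon>")
  case False
  then have "unsigned_wt n \<tau> \<sigma> * moebius n \<sigma> \<upsilon> = 0" for \<sigma>
    by (auto simp: unsigned_wt_def moebius_def same_signs_def)
  then have "power_sum_coeff n \<tau> \<upsilon> = 0"
    unfolding power_sum_coeff_def by (intro sum.neutral) blast
  then show ?thesis using False by simp
next
  case True
  let ?X = "{S. fst \<upsilon> \<subseteq> S \<and> S \<subseteq> {1..n} \<and> left_filled (fst \<tau>) S}"
  define g where "g S = (S, restrict (sign_vector \<upsilon>) S)" for S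
  have n: "n \<in> fst \<upsilon>" using SigmaB_D[OF \<upsilon>] by simp
  have same: "same_signs n (g S) \<upsilon>" if "S \<in> ?X" for S
    unfolding same_signs_def g_def
    using that n by (intro ballI sign_vector_restrict) (auto intro: sign_vector_Suc)
  have "power_sum_coeff n \<tau> \<upsilon> = (\<Sum>\<sigma>\<in>g ` ?X. unsigned_wt n \<tau> \<sigma> * moebius n \<sigma> \<upsilon>)"
    unfolding power_sum_coeff_def
  proof (intro sum.mono_neutral_right finite_SigmaB ballI)
    show "g ` ?X \<subseteq> SigmaB n"
      using n unfolding g_def by (intro image_subsetI restrict_mem_SigmaB) auto
    fix \<sigma> assume \<sigma>: "\<sigma> \<in> SigmaB n - g ` ?X"
    show "unsigned_wt n \<tau> \<sigma> * moebius n \<sigma> \<upsilon> = 0"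
    proof (rule ccontr)
      assume "unsigned_wt n \<tau> \<sigma> * moebius n \<sigma> \<upsilon> \<noteq> 0"
      then have nz: "left_filled (fst \<tau>) (fst \<sigma>)" "fst \<upsilon> \<subseteq> fst \<sigma>" "same_signs n \<sigma> \<upsilon>"
        by (auto simp: unsigned_wt_def moebius_def split: if_splits)
      then have "\<sigma> = g (fst \<sigma>)"
        using \<sigma> unfolding g_def by (intro SigmaB_eq_restrict) (auto simp: same_signs_def)
      moreover have "fst \<sigma> \<in> ?X" using nz \<sigma> SigmaB_D(2)[of \<sigma> n] by auto
      ultimately show False using \<sigma> by blast
    qed
  qed
  also have "\<dots> = (\<Sum>S\<in>?X. unsigned_wt n \<tau> (g S) * moebius n (g S) \<upsilon>)"
    by (subst sum.reindex) (auto simp: inj_on_def g_def)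
  also have "\<dots> = (\<Sum>S\<in>?X. (-1) ^ card (S - fst \<tau>) * (-1) ^ card (S - fst \<upsilon>))"
  proof (rule sum.cong[OF refl])
    fix S assume S: "S \<in> ?X"
    then have "same_signs n \<tau> (g S)" using same[OF S] True by (simp add: same_signs_def)
    moreover have "fst (g S) = S" by (simp add: g_def)
    ultimately show "unsigned_wt n \<tau> (g S) * moebius n (g S) \<upsilon> =
        (-1) ^ card (S - fst \<tau>) * (-1) ^ card (S - fst \<upsilon>)"
      using S same[OF S] by (simp add: unsigned_wt_def moebius_def)
  qed
  finally show ?thesis using True by simp
qed

text \<open>Toggling an element \<open>t \<in> T - U\<close> in \<open>S\<close> changes neither \<open>S - T\<close> nor \<open>S \<union> T\<close>, but flips the
  parity of \<open>S - U\<close>.\<close>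

lemma sum_left_filled_eq_0:
  assumes t: "t \<in> T" "t \<notin> U" "t \<in> {1..n}"
  shows "(\<Sum>S | U \<subseteq> S \<and> S \<subseteq> {1..n} \<and> left_filled T S.
    (-1) ^ card (S - T) * (-1) ^ card (S - U)) = (0 :: real)"
proof -
  let ?X = "{S. U \<subseteq> S \<and> S \<subseteq> {1..n} \<and> left_filled T S}"
  let ?f = "\<lambda>S. (-1) ^ card (S - T) * (-1) ^ card (S - U) :: real"
  define flip where "flip S = (if t \<in> S then S - {t} else insert t S)" for S
  have diff: "flip S - T = S - T" and union: "flip S \<union> T = S \<union> T" for S
    using t(1) by (auto simp: flip_def)
  have mem: "flip S \<in> ?X" if "S \<in> ?X" for S
  proof -
    \<comment> \<open>\<open>left_filled\<close> depends on S only through S - T and S \<union>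
      T.\<close>
    have "left_filled T (flip S)" using that by (simp add: left_filled_def diff union)
    then show ?thesis using that t by (auto simp: flip_def)
  qed
  have flip_flip: "flip (flip S) = S" for S by (auto simp: flip_def)
  have sgn: "?f (flip S) = - ?f S" if "S \<in> ?X" for S
  proof -
    have fin: "finite S" using that finite_subset[of S "{1..n}"] by auto
    have "(-1) ^ card (flip S - U) = - ((-1) ^ card (S - U) :: real)"
    proof (cases "t \<in> S")
      case True
      then have "S - U = insert t (flip S - U)" "t \<notin> flip S - U"
        using t(2) by (auto simp: flip_def)
      moreover have "finite (flip S - U)" using fin by (simp add: flip_def)
      ultimately have "card (S - U) = Suc (card (flip S - U))" by (metis card_insert_disjoint)
      then show ?thesis by simp
    next
      case False
      then have "flip S - U = insert t (S - U)" using t(2) by (auto simp: flip_def)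
      then have "card (flip S - U) = Suc (card (S - U))" using fin False by simp
      then show ?thesis by simp
    qed
    then show ?thesis by (simp add: diff)
  qed
  have "sum ?f ?X = (\<Sum>S\<in>?X. - ?f S)"
    by (rule sum.reindex_bij_witness[where i = flip and j = flip])
      (use mem flip_flip sgn in auto)
  then show ?thesis by (simp add: sum_negf)
qed

text \<open>The toggling cancellation forces inclusion of the underlying sets; if these are equal,
  the common sign vector forces \<tau> = \<upsilon>.\<close>

lemma power_sum_coeff_triangular:
  assumes \<tau>: "\<tau> \<in> SigmaB n" and \<upsilon>: "\<upsilon> \<in> SigmaB n" and nz: "power_sum_coeff n \<tau> \<upsilon> \<noteq> 0"
  shows "\<tau> = \<upsilon> \<or> card (fst \<tau>) < card (fst \<upsilon>)"
proof -
  have same: "same_signs n \<tau> \<upsilon>"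
    using nz by (auto simp: power_sum_coeff_eq[OF \<upsilon>] split: if_splits)
  have "fst \<tau> \<subseteq> fst \<upsilon>"
  proof (rule ccontr)
    assume "\<not> fst \<tau> \<subseteq> fst \<upsilon>"
    then obtain t where "t \<in> fst \<tau>" "t \<notin> fst \<upsilon>" by blast
    moreover from this have "t \<in> {1..n}" using SigmaB_D(2)[OF \<tau>] by blast
    ultimately show False
      using nz same sum_left_filled_eq_0[of t "fst \<tau>" "fst \<upsilon>" n] by (simp add: power_sum_coeff_eq[OF \<upsilon>])
  qed
  then have "fst \<tau> = fst \<upsilon> \<or> card (fst \<tau>) < card (fst \<upsilon>)"
    using SigmaB_D(3)[OF \<upsilon>] psubset_card_mono by blast
  then show ?thesis using same_signs_eqI[OF \<tau> \<upsilon>] same by blast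
qed

text \<open>Both signs have the same exponent here, so every set counts with weight 1.\<close>

lemma power_sum_coeff_diagonal:
  assumes \<tau>: "\<tau> \<in> SigmaB n"
  shows "power_sum_coeff n \<tau> \<tau> = real (card (fillings n (fst \<tau>)))"
proof -
  have "(-1) ^ k * (-1) ^ k = (1 :: real)" for k :: nat
    by (simp flip: power_mult_distrib)
  then show ?thesis
    by (simp add: power_sum_coeff_eq[OF \<tau>] same_signs_def fillings_def)
qed

lemma moebius_triangular:
  assumes \<sigma>: "\<sigma> \<in> SigmaB n" and \<upsilon>: "\<upsilon> \<in> SigmaB n" and nz: "moebius n \<sigma> \<upsilon> \<noteq> 0"
  shows "\<sigma> = \<upsilon> \<or> card (fst \<upsilon>) < card (fst \<sigma>)"
proof -
  have "fst \<upsilon> \<subseteq> fst \<sigma>" "same_signs n \<sigma> \<upsilon>" using nz by (auto simp: moebius_def split: if_splits)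
  then show ?thesis
    using SigmaB_D(3)[OF \<sigma>] psubset_card_mono[of "fst \<sigma>" "fst \<upsilon>"] same_signs_eqI[OF \<sigma> \<upsilon>] by blast
qed

lemma moebius_diagonal: "moebius n \<sigma> \<sigma> = 1"
  by (simp add: moebius_def same_signs_def)

section \<open>The determinant from the factors H, B and C\<close>

theorem theorem4p5:
  fixes n :: nat
    and rs :: "signed_composition list"
    and cs :: "(nat set \<times> (nat \<Rightarrow> sign)) list"
  assumes "n \<ge> 1"
    and "distinct rs" and "set rs = CompB n"
    and "distinct cs" and "set cs = SigmaB n"
  shows "weight_matrix rs cs \<in> carrier_mat (2 * 3 ^ (n - 1)) (2 * 3 ^ (n - 1)) \<and>
         invertible_mat (weight_matrix rs cs) \<and>
         \<bar>det (weight_matrix rs cs)\<bar> = (\<Prod>\<gamma>\<in>CompB n. m_comp \<gamma>)"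
proof -
  define d :: nat where "d = 2 * 3 ^ (n - 1)"
  have cs: "length cs = d"
    using distinct_card[OF assms(4)] card_SigmaB[OF assms(1)] assms(5) by (simp add: d_def)
  have bij: "bij_betw sigma_of (CompB n) (SigmaB n)" using assms(1) by (rule bij_betw_sigma_of)
  have rs: "length rs = d"
    using distinct_card[OF assms(2)] bij_betw_same_card[OF bij] card_SigmaB[OF assms(1)] assms(3)
    by (simp add: d_def)
  define A where "A = family_mat (\<lambda>\<gamma> \<sigma>. real_of_int (wt \<gamma> \<sigma>)) rs cs"
  define H where "H = family_mat bar_character rs cs"
  define B where "B = family_mat (unsigned_wt n) cs cs"
  define C where "C = family_mat (moebius n) cs cs"
  define P where "P = family_mat (power_sum_coeff n) cs cs"
  have carrier: "A \<in> carrier_mat d d" "H \<in> carrier_mat d d" "B \<in> carrier_mat d d"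
    "C \<in> carrier_mat d d" "P \<in> carrier_mat d d"
    unfolding A_def H_def B_def C_def P_def using family_mat_carrier[of _ rs cs]
      family_mat_carrier[of _ cs cs] rs cs by auto
  have weight: "weight_matrix rs cs = A"
    by (simp add: weight_matrix_def A_def family_mat_def)

  have HB: "H * B = A"
    unfolding A_def H_def B_def
    by (rule family_mat_mult) (use assms sum_bar_character_unsigned_wt in auto)
  have BC: "B * C = P"
    unfolding B_def C_def P_def
    by (rule family_mat_mult) (use assms in \<open>auto simp: power_sum_coeff_def\<close>)
  \<comment> \<open>The rows of C are supported on smaller sets, hence the negated cardinality as
    rank.\<close>
  have "det C = (\<Prod>\<sigma>\<in>set cs. moebius n \<sigma> \<sigma>)"
    unfolding C_def using moebius_triangular assms(4,5)
    by (intro det_family_mat_triangular[where r = "\<lambda>\<sigma>. - int (card (fst \<sigma>))"]) auto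
  then have det_C: "det C = 1" by (simp add: moebius_diagonal)
  have "det P = (\<Prod>\<sigma>\<in>set cs. power_sum_coeff n \<sigma> \<sigma>)"
    unfolding P_def using power_sum_coeff_triangular assms(4,5)
    by (intro det_family_mat_triangular[where r = "\<lambda>\<sigma>. int (card (fst \<sigma>))"]) auto
  also have "\<dots> = (\<Prod>\<sigma>\<in>SigmaB n. real (card (fillings n (fst \<sigma>))))"
    unfolding assms(5) by (intro prod.cong refl power_sum_coeff_diagonal)
  \<comment> \<open>Reindexing along \<open>sigma_of\<close>, which preserves the underlying
    set.\<close>
  also have "\<dots> = (\<Prod>\<gamma>\<in>CompB n. real (card (fillings n (partial_sum_set \<gamma>))))"
    by (simp flip: prod.reindex_bij_betw[OF bij])
  also have "\<dots> = (\<Prod>\<gamma>\<in>CompB n. \<Prod>p\<leftarrow>\<gamma>. real (fst p))"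
  proof (rule prod.cong[OF refl])
    have "real (prod_list ks) = (\<Prod>k\<leftarrow>ks. real k)" for ks :: "nat list"
      by (induction ks) auto
    then show "real (card (fillings n (partial_sum_set \<gamma>))) = (\<Prod>p\<leftarrow>\<gamma>. real (fst p))"
      if "\<gamma> \<in> CompB n" for \<gamma>
      using card_fillings_partial_sum_set[OF that] by (simp add: comp_def)
  qed
  finally have det_P: "det P = (\<Prod>\<gamma>\<in>CompB n. \<Prod>p\<leftarrow>\<gamma>. real (fst p))" .

  \<comment> \<open>Rows and columns of H have different index sets, so its determinant is reached
    through the Gram matrix, and only up to sign.\<close>
  have "H * transpose_mat H = family_mat (\<lambda>\<gamma> \<gamma>'. if \<gamma> = \<gamma>' then 2 ^ length \<gamma> else 0) rs rs"
    unfolding H_def transpose_family_mat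
    by (rule family_mat_mult) (use assms sum_bar_character_orthogonal in auto)
  then have "det H * det H =
      det (family_mat (\<lambda>\<gamma> \<gamma>'. if \<gamma> = \<gamma>' then 2 ^ length \<gamma> else 0) rs rs)"
    using det_mult[OF carrier(2), of "transpose_mat H"] det_transpose[OF carrier(2)] carrier(2)
    by simp
  \<comment> \<open>With a constant rank no strict increase is possible, so triangular means
    diagonal.\<close>
  also have "\<dots> = (\<Prod>\<gamma>\<in>set rs. if \<gamma> = \<gamma> then 2 ^ length \<gamma> else 0)"
    by (rule det_family_mat_triangular[OF assms(2), where r = "\<lambda>_. 0"]) (simp split: if_splits)
  also have "\<dots> = (\<Prod>\<gamma>\<in>CompB n. 2 ^ length \<gamma>)"
    by (simp add: assms(3))
  also have "\<dots> = (\<Prod>\<gamma>\<in>CompB n. 2 powr (real (length \<gamma>) / 2))\<^sup>2"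
    by (simp add: power2_eq_square powr_realpow flip: prod.distrib powr_add)
  finally have "\<bar>det H\<bar>\<^sup>2 = (\<Prod>\<gamma>\<in>CompB n. 2 powr (real (length \<gamma>) / 2))\<^sup>2"
    by (simp add: power2_eq_square)
  then have det_H: "\<bar>det H\<bar> = (\<Prod>\<gamma>\<in>CompB n. 2 powr (real (length \<gamma>) / 2))"
    by (rule power2_eq_imp_eq) (auto intro: prod_nonneg)

  \<comment> \<open>As \<open>det C\<close> is 1, B and P have the same determinant.\<close>
  have "det A = det H * det P"
    using det_mult[OF carrier(2,3)] det_mult[OF carrier(3,4)] by (simp add: HB BC det_C)
  moreover have parts_pos: "0 < (\<Prod>p\<leftarrow>\<gamma>. real (fst p))" if "\<gamma> \<in> CompB n" for \<gamma>
  proof -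
    have "(\<forall>p\<in>set ps. 0 < fst p) \<Longrightarrow> 0 < (\<Prod>p\<leftarrow>ps. real (fst p))" for ps :: signed_composition
      by (induction ps) auto
    then show ?thesis using that by (simp add: CompB_def)
  qed
  \<comment> \<open>The absolute value therefore affects only \<open>det H\<close>, whose sign
    depends on the chosen orders.\<close>
  moreover from parts_pos have "0 \<le> det P"
    unfolding det_P by (intro prod_nonneg less_imp_le)
  ultimately have det_A: "\<bar>det A\<bar> = (\<Prod>\<gamma>\<in>CompB n. m_comp \<gamma>)"
    by (simp add: abs_mult det_H m_comp_def prod.distrib det_P)
  have "0 < (\<Prod>\<gamma>\<in>CompB n. m_comp \<gamma>)"
    using parts_pos by (intro prod_pos) (simp add: m_comp_def)
  then have "invertible_mat A"
    using det_A by (intro invertible_mat_of_det_ne_0[OF carrier(1)]) auto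
  then show ?thesis using carrier(1) det_A by (simp add: weight d_def)
qed

end
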